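(* For each positive integer $N$, there exists a real number $\rho_N\leq -1$ such that if $a<\rho_N$, then $\overline{R(c)}$ is a union of at least $N$ disjoint closed sets.
   Context: $\mathbb N$ is the set of positive integers. $c$ denotes a complex number with real part $a$. The divisor function $\sigma_c\colon\mathbb N\to\mathbb C$ is defined by $\sigma_c(n)=\sum_{d\mid n}d^c$ (sum over the positive divisors $d$ of $n$), where $d^c=e^{c\log d}$ with the real logarithm $\log d$. $R(c)=\{\sigma_c(n)\colon n\in\mathbb N\}$ is the range of $\sigma_c$, and $\overline{R(c)}$ is its closure in $\mathbb C$. The number $\rho_N$ depends only on $N$, and the conclusion holds for every complex $c$ whose real part $a$ satisfies $a<\rho_N$. *)

theory Defs
  imports "HOL-Analysis.Analysis" "HOL-Library.Disjoint_Sets"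
begin

definition divisor_sigma :: "complex \<Rightarrow> nat \<Rightarrow> complex" where
  "divisor_sigma c n = (\<Sum>d | d dvd n. of_nat d powr c)"

text \<open>The principal branch used by \<open>powr\<close> is the real logarithm at positive integers.\<close>

lemma of_nat_powr_eq_exp_real_ln:
  fixes c :: complex
  assumes "d > 0"
  shows "of_nat d powr c = exp (c * complex_of_real (ln (real d)))"
  using assms by (simp add: powr_def Ln_of_nat)

text \<open>Only positive arguments: \<open>divisor_sigma c 0\<close> is a sum over an infinite set, hence \<open>0\<close>
  by convention, and must not contribute to the range.\<close>

definition divisor_sigma_range :: "complex \<Rightarrow> complex set" where
  "divisor_sigma_range c = divisor_sigma c ` {n. n > 0}"

text \<open>The parts must be nonempty so that each one counts, and finite in number: an infinite family
  of parts is available for every infinite Hausdorff space, namely its singletons.\<close>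

definition union_of_at_least_disjoint_closed :: "nat \<Rightarrow> 'a::topological_space set \<Rightarrow> bool" where
  "union_of_at_least_disjoint_closed N X \<longleftrightarrow>
     (\<exists>F. finite F \<and> card F \<ge> N \<and> (\<forall>S\<in>F. closed S \<and> S \<noteq> {}) \<and> disjoint F \<and> \<Union>F = X)"

end

theory Submission
  imports Defs
begin

text \<open>When \<open>Re c\<close> is very negative, the terms of \<open>\<Sum>d | d dvd n. d\<^sup>c\<close> decay so fast that each of the
  first few outweighs everything after it, as with the digits of a number in a large base. Let
  \<open>k \<le> N\<close> be the least number that divides one of two positive integers and not the other. Then their
  \<open>\<sigma>\<^sub>c\<close>-values differ by \<open>\<plusminus> k\<^sup>c\<close> and an error of modulus at most \<open>\<Sum>d>k. d\<^sup>a\<close>, where \<open>a = Re c\<close>; once \<open>a\<close> is below a bound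
  depending only on \<open>N\<close>, this tail is at most half of \<open>k\<^sup>a\<close> (\<open>powr_tail_le_half\<close>), so that the values
  are at least \<open>N\<^sup>a / 2\<close> apart (\<open>divisor_sigma_apart\<close>).

  Now sort the positive integers by their sets of divisors up to \<open>N\<close>. There are finitely many
  classes, and at least \<open>N\<close> of them, since \<open>1, \<dots>, N\<close> lie in different ones. The images of the classes
  are a positive distance apart, so their closures are disjoint, and together these make up the closure
  of the range (\<open>closed_parts_of_separated_classes\<close>).\<close>

lemma closure_UN_finite: "finite I \<Longrightarrow> closure (\<Union>i\<in>I. S i) = (\<Union>i\<in>I. closure (S i))"
  by (induction I rule: finite_induct) simp_all

text \<open>A positive distance between two sets persists between their closures, which are therefore disjoint; finiteness
  of the set of classes lets closure commute with the union.\<close>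

lemma closed_parts_of_separated_classes:
  fixes f :: "'i \<Rightarrow> 'a::metric_space" and g :: "'i \<Rightarrow> 'b"
  assumes fin: "finite (g ` A)" and "\<delta> > 0"
    and apart: "\<And>x y. x \<in> A \<Longrightarrow> y \<in> A \<Longrightarrow> g x \<noteq> g y \<Longrightarrow> \<delta> \<le> dist (f x) (f y)"
  shows "union_of_at_least_disjoint_closed (card (g ` A)) (closure (f ` A))"
proof -
  define P where "P s = closure (f ` {x \<in> A. g x = s})" for s
  have nonempty: "P s \<noteq> {}" if "s \<in> g ` A" for s
    using that by (auto simp: P_def)
  have disj: "P s \<inter> P t = {}" if "s \<noteq> t" for s t
  proof (rule ccontr)
    assume "P s \<inter> P t \<noteq> {}"
    then obtain z where "z \<in> P s" "z \<in> P t" by blast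
    moreover have "\<delta> / 2 > 0" using \<open>\<delta> > 0\<close> by simp
    ultimately obtain x y where x: "x \<in> A" "g x = s" "dist (f x) z < \<delta> / 2"
      and y: "y \<in> A" "g y = t" "dist (f y) z < \<delta> / 2"
      unfolding P_def closure_approachable by blast
    have "dist (f x) (f y) < \<delta>"
      using x(3) y(3) by (rule dist_triangle_half_r[of z, unfolded dist_commute[of z]])
    with apart[of x y] x y \<open>s \<noteq> t\<close> show False by auto
  qed
  have "inj_on P (g ` A)"
    using nonempty disj by (metis inf.idem inj_onI)
  then have "card (P ` g ` A) = card (g ` A)" by (rule card_image)
  moreover have "disjoint (P ` g ` A)"
    using disj unfolding disjoint_def by (metis imageE)
  moreover have "\<Union>(P ` g ` A) = closure (f ` A)"
  proof -
    have "f ` A = (\<Union>s\<in>g ` A. f ` {x \<in> A. g x = s})" by auto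
    then show ?thesis
      using closure_UN_finite[OF fin, of "\<lambda>s. f ` {x \<in> A. g x = s}"] by (simp only: P_def [abs_def])
  qed
  moreover have "\<forall>S\<in>P ` g ` A. closed S \<and> S \<noteq> {}"
    using nonempty by (auto simp: P_def)
  ultimately show ?thesis
    unfolding union_of_at_least_disjoint_closed_def using fin
    by (intro exI[of _ "P ` g ` A"]) auto
qed

lemma sum_inverse_squares_le_one:
  assumes "k > 0"
  shows "(\<Sum>d\<in>{k<..L}. 1 / (real d)\<^sup>2) \<le> 1"
proof -
  have "(\<Sum>d\<in>{k<..L}. 1 / (real d)\<^sup>2) \<le> 1 / real k - 1 / real L" if "k \<le> L"
    using that
  proof (induction L rule: dec_induct)
    case (step L)
    then have "{k<..Suc L} = insert (Suc L) {k<..L}" "L > 0" using \<open>k > 0\<close> by auto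
    \<comment> \<open>The sum telescopes against \<open>1/L - 1/(L+1) = 1/(L(L+1))\<close>.\<close>
    moreover have "1 / (real (Suc L))\<^sup>2 \<le> 1 / real L - 1 / real (Suc L)"
    proof -
      have "1 / (real (Suc L))\<^sup>2 \<le> 1 / (real L * real (Suc L))"
        using \<open>L > 0\<close> by (intro divide_left_mono) (auto simp: power2_eq_square)
      also have "\<dots> = 1 / real L - 1 / real (Suc L)"
        using \<open>L > 0\<close> by (simp add: field_simps)
      finally show ?thesis .
    qed
    ultimately show ?case using step.IH step.hyps by simp
  qed simp
  moreover have "1 / real k \<le> 1" "1 / real L \<ge> 0" using \<open>k > 0\<close> by auto
  moreover have "(\<Sum>d\<in>{k<..L}. 1 / (real d)\<^sup>2) = 0" if "\<not> k \<le> L"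
    using that by simp
  ultimately show ?thesis by linarith
qed

text \<open>Splitting \<open>d powr a\<close> as \<open>d powr (a + 2) / d\<^sup>2\<close> bounds the tail by \<open>(k + 1) powr (a + 2)\<close>. The ratio
  of \<open>(k + 1) powr a\<close> to \<open>k powr a\<close> is at most \<open>(1 + 1/N) powr a\<close>, which tends to \<open>0\<close> as \<open>a\<close> tends to
  \<open>-\<infinity>\<close> and so beats the factor \<open>(k + 1)\<^sup>2 \<le> (N + 1)\<^sup>2\<close>.\<close>

lemma powr_tail_le_half:
  fixes N :: nat
  obtains \<rho> :: real where "\<rho> \<le> -1"
    and "\<And>a k L. a < \<rho> \<Longrightarrow> 0 < k \<Longrightarrow> k \<le> N \<Longrightarrow> (\<Sum>d\<in>{k<..L}. real d powr a) \<le> real k powr a / 2"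
proof (cases "N = 0")
  case True
  then show ?thesis using that[of "-1"] by simp
next
  case False
  define q where "q = 1 + 1 / real N"
  have "q > 1" using False by (simp add: q_def)
  then obtain j where j: "2 * (real N + 1)\<^sup>2 < q ^ j" using real_arch_pow by blast
  have "(\<Sum>d\<in>{k<..L}. real d powr a) \<le> real k powr a / 2"
    if a: "a < - real j - 2" and k: "0 < k" "k \<le> N" for a k L
  proof -
    let ?K = "real (Suc k)"
    have "(\<Sum>d\<in>{k<..L}. real d powr a) \<le> (\<Sum>d\<in>{k<..L}. ?K powr (a + 2) * (1 / (real d)\<^sup>2))"
    proof (rule sum_mono)
      fix d assume d: "d \<in> {k<..L}"
      then have "real d powr a = real d powr (a + 2) * (1 / (real d)\<^sup>2)"
        by (simp add: powr_add)
      also have "\<dots> \<le> ?K powr (a + 2) * (1 / (real d)\<^sup>2)"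
        using d a by (intro mult_right_mono powr_mono2') auto
      finally show "real d powr a \<le> ?K powr (a + 2) * (1 / (real d)\<^sup>2)" .
    qed
    also have "\<dots> \<le> ?K powr (a + 2)"
      unfolding sum_distrib_left[symmetric]
      using sum_inverse_squares_le_one[OF k(1)] by (intro mult_left_le) auto
    also have "\<dots> = ?K\<^sup>2 * ?K powr a" by (simp add: powr_add)
    also have "\<dots> \<le> (q ^ j / 2) * ?K powr a"
    proof -
      have "?K\<^sup>2 \<le> (real N + 1)\<^sup>2" using k by (intro power_mono) auto
      with j have "?K\<^sup>2 \<le> q ^ j / 2" by linarith
      then show ?thesis by (intro mult_right_mono) auto
    qed
    also have "\<dots> \<le> ((?K / real k) powr (- a) / 2) * ?K powr a"
    proof -
      have "q \<le> ?K / real k" using k by (simp add: q_def field_simps)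
      then have "q powr real j \<le> (?K / real k) powr real j"
        using \<open>q > 1\<close> by (intro powr_mono2) auto
      also have "\<dots> \<le> (?K / real k) powr (- a)"
        using a k by (intro powr_mono) (auto simp: field_simps)
      finally show ?thesis using \<open>q > 1\<close>
        by (intro mult_right_mono) (auto simp: powr_realpow)
    qed
    also have "\<dots> = real k powr a / 2"
      using k by (simp add: powr_divide powr_minus field_simps)
    finally show ?thesis .
  qed
  then show ?thesis using that[of "- real j - 2"] by simp
qed

lemma norm_of_nat_powr: "norm (of_nat d powr c :: complex) = real d powr Re c"
  by (simp add: norm_powr_real_powr)

lemma divisor_sigma_eq_sum_upto:
  assumes "n > 0" "n \<le> L"
  shows "divisor_sigma c n = (\<Sum>d\<in>{1..L}. of_bool (d dvd n) * of_nat d powr c)"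
proof -
  have "d dvd n \<Longrightarrow> d \<in> {1..L}" for d
    using assms dvd_imp_le[of d n] dvd_pos_nat[of n d] by auto
  then show ?thesis
    unfolding divisor_sigma_def by (intro sum.mono_neutral_cong_left) auto
qed

text \<open>Divisors below \<open>k\<close> are common to \<open>n\<close> and \<open>m\<close> and cancel in the difference. Beyond \<open>k\<close>
  each \<open>d\<^sup>c\<close> survives with a coefficient in \<open>{-1, 0, 1}\<close>, whatever the divisors are.\<close>

lemma divisor_sigma_dist_ge:
  assumes "n > 0" "m > 0" and least: "\<And>d. d < k \<Longrightarrow> d dvd n \<longleftrightarrow> d dvd m"
    and k: "k dvd n" "\<not> k dvd m"
  shows "real k powr Re c - (\<Sum>d\<in>{k<..n + m}. real d powr Re c)
    \<le> dist (divisor_sigma c n) (divisor_sigma c m)"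
proof -
  define h :: "nat \<Rightarrow> complex"
    where "h d = (of_bool (d dvd n) - of_bool (d dvd m)) * of_nat d powr c" for d
  have "k > 0" "k \<le> n + m" using k \<open>n > 0\<close> by (auto dest: dvd_imp_le intro: Nat.gr0I)
  then have "{1..n + m} = {1..<k} \<union> insert k {k<..n + m}" by auto
  then have "(\<Sum>d\<in>{1..n + m}. h d) = (\<Sum>d\<in>insert k {k<..n + m}. h d)"
    using least by (intro sum.mono_neutral_right) (auto simp: h_def)
  also have "\<dots> = of_nat k powr c + (\<Sum>d\<in>{k<..n + m}. h d)"
    using k by (simp add: h_def)
  finally have "divisor_sigma c n - divisor_sigma c m
      = of_nat k powr c + (\<Sum>d\<in>{k<..n + m}. h d)"
    using assms(1,2) by (simp add: divisor_sigma_eq_sum_upto[of _ "n + m"] h_def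
        left_diff_distrib sum_subtractf)
  moreover have "norm (\<Sum>d\<in>{k<..n + m}. h d) \<le> (\<Sum>d\<in>{k<..n + m}. real d powr Re c)"
    by (rule sum_norm_le) (simp add: h_def norm_mult norm_of_nat_powr)
  ultimately show ?thesis
    using norm_diff_ineq[of "of_nat k powr c" "\<Sum>d\<in>{k<..n + m}. h d"]
    by (simp add: dist_norm norm_of_nat_powr)
qed

text \<open>The gap \<open>k powr Re c / 2\<close> depends on the pair through \<open>k\<close>; as \<open>Re c \<le> 0\<close>, its value at \<open>k = N\<close> is
  the smallest and serves for all pairs.\<close>

lemma divisor_sigma_apart:
  assumes tail: "\<And>k L. 0 < k \<Longrightarrow> k \<le> N
      \<Longrightarrow> (\<Sum>d\<in>{k<..L}. real d powr Re c) \<le> real k powr Re c / 2"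
    and "Re c \<le> 0" "n > 0" "m > 0" and differ: "{d\<in>{1..N}. d dvd n} \<noteq> {d\<in>{1..N}. d dvd m}"
  shows "real N powr Re c / 2 \<le> dist (divisor_sigma c n) (divisor_sigma c m)"
proof -
  define k where "k = (LEAST d. (d dvd n) \<noteq> (d dvd m))"
  obtain d where d: "d \<in> {1..N}" "(d dvd n) \<noteq> (d dvd m)" using differ by blast
  have k: "(k dvd n) \<noteq> (k dvd m)" "k \<le> d"
    unfolding k_def using d(2) by (rule LeastI, rule Least_le)
  have least: "i dvd n \<longleftrightarrow> i dvd m" if "i < k" for i
    using not_less_Least that unfolding k_def by blast
  have "k > 0" using k \<open>n > 0\<close> \<open>m > 0\<close> by (intro Nat.gr0I) auto
  moreover have "k \<le> N" using k d by simp
  ultimately have "(\<Sum>d\<in>{k<..n + m}. real d powr Re c) \<le> real k powr Re c / 2"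
    and "real N powr Re c \<le> real k powr Re c"
    using tail \<open>Re c \<le> 0\<close> by (auto intro: powr_mono2')
  moreover have "real k powr Re c - (\<Sum>d\<in>{k<..n + m}. real d powr Re c)
      \<le> dist (divisor_sigma c n) (divisor_sigma c m)"
    using k divisor_sigma_dist_ge[of n m k c] divisor_sigma_dist_ge[of m n k c] least
      \<open>n > 0\<close> \<open>m > 0\<close> by (auto simp: dist_commute add.commute)
  ultimately show ?thesis by linarith
qed

lemma card_small_divisor_sets_ge: "N \<le> card ((\<lambda>n. {d\<in>{1..N}. d dvd n}) ` {n. n > 0})"
proof -
  let ?g = "\<lambda>n. {d\<in>{1..N}. d dvd n}"
  have "inj_on ?g {1..N}"
  proof (rule inj_onI)
    fix n m assume "n \<in> {1..N}" "m \<in> {1..N}" "?g n = ?g m"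
    then have "n \<in> ?g m" "m \<in> ?g n" by (metis (lifting) dvd_refl mem_Collect_eq)+
    then have "n dvd m" "m dvd n" by simp_all
    then show "n = m" by (rule dvd_antisym)
  qed
  then have "N = card (?g ` {1..N})" by (simp add: card_image)
  also have "\<dots> \<le> card (?g ` {n. n > 0})"
    by (rule card_mono) (auto intro: finite_subset[of _ "Pow {1..N}"])
  finally show ?thesis .
qed

theorem theorem3p3:
  fixes N :: nat
  assumes "N > 0"
  shows "\<exists>\<rho>::real. \<rho> \<le> -1 \<and>
    (\<forall>c::complex. Re c < \<rho> \<longrightarrow>
       union_of_at_least_disjoint_closed N (closure (divisor_sigma_range c)))"
proof -
  obtain \<rho> where "\<rho> \<le> -1" and tail: "\<And>a k L. a < \<rho> \<Longrightarrow> 0 < k \<Longrightarrow> k \<le> N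
      \<Longrightarrow> (\<Sum>d\<in>{k<..L}. real d powr a) \<le> real k powr a / 2"
    using powr_tail_le_half by blast
  have "union_of_at_least_disjoint_closed N (closure (divisor_sigma_range c))"
    if c: "Re c < \<rho>" for c
  proof -
    let ?g = "\<lambda>n. {d\<in>{1..N}. d dvd n}"
    have "union_of_at_least_disjoint_closed (card (?g ` {n. n > 0})) (closure (divisor_sigma_range c))"
      unfolding divisor_sigma_range_def
    proof (rule closed_parts_of_separated_classes)
      show "finite (?g ` {n. n > 0})" by (auto intro: finite_subset[of _ "Pow {1..N}"])
      show "real N powr Re c / 2 > 0" using \<open>N > 0\<close> by simp
      show "real N powr Re c / 2 \<le> dist (divisor_sigma c n) (divisor_sigma c m)"
        if "n \<in> {n. n > 0}" "m \<in> {n. n > 0}" "?g n \<noteq> ?g m" for n m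
        using that c \<open>\<rho> \<le> -1\<close> tail[OF c] by (intro divisor_sigma_apart) auto
    qed
    then show ?thesis
      using card_small_divisor_sets_ge[of N]
      unfolding union_of_at_least_disjoint_closed_def by (meson order_trans)
  qed
  with \<open>\<rho> \<le> -1\<close> show ?thesis by blast
qed

end
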